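(* Let $0\le\lambda<1$, $c>-1$ and let $\sigma$ be real. If $-\lambda\le c\le1-2\lambda$, then $f\in S^*_\sigma(\lambda)$ implies $I^\sigma f\in S^*_c(\lambda)$.
   Context: $U=\{z\in\mathbb{C}:|z|<1\}$. $A$ is the class of functions $f(z)=z+\sum_{n=2}^\infty a_nz^n$ analytic in $U$, and $S\subset A$ is the subclass of functions univalent in $U$. Quotients such as $zf'(z)/f(z)$ are understood with the removable singularity at $z=0$ filled in. For $0\le\lambda<1$, $S^*(\lambda)$ (starlike functions of order $\lambda$) is the set of $f\in S$ with $\operatorname{Re}\{zf'(z)/f(z)\}>\lambda$ for all $z\in U$. For $c>-1$ and $f\in A$, the generalized Bernardi-Libera-Livingston operator is $L_cf(z)=\frac{c+1}{z^c}\int_0^z t^{c-1}f(t)\,dt$; equivalently $L_cf(z)=z+\sum_{n=2}^\infty\frac{c+1}{n+c}a_nz^n$. For $\sigma>0$ and $f\in A$, $I^\sigma f(z)=\frac{2^\sigma}{z\Gamma(\sigma)}\int_0^z\left(\log\frac{z}{t}\right)^{\sigma-1}f(t)\,dt$; equivalently $I^\sigma f(z)=z+\sum_{n=2}^\infty\left(\frac{2}{n+1}\right)^\sigma a_nz^n$, and this series defines $I^\sigma$ for every real $\sigma$. A subscript $c$ refers to $L_c$ and a subscript $\sigma$ refers to $I^\sigma$: $S^*_c(\lambda)=\{f\in A: L_cf\in S^*(\lambda)\}$ and $S^*_\sigma(\lambda)=\{f\in A: I^\sigma f\in S^*(\lambda)\}$. *)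

theory Defs
  imports "HOL-Complex_Analysis.Complex_Analysis"
begin

text \<open>
  Functions on the unit disc are represented by total functions of type
  \<open>complex \<Rightarrow> complex\<close>; only their values on \<open>ball 0 1\<close> matter.
\<close>

definition class_A :: "(complex \<Rightarrow> complex) set" where
  "class_A = {f. f holomorphic_on ball 0 1 \<and> f 0 = 0 \<and> deriv f 0 = 1}"

definition class_S :: "(complex \<Rightarrow> complex) set" where
  "class_S = {f \<in> class_A. inj_on f (ball 0 1)}"

text \<open>\<open>remove_sings\<close> fills in the removable singularity of the quotient at \<open>0\<close>.\<close>

definition starlike_of_order :: "real \<Rightarrow> (complex \<Rightarrow> complex) set" where
  "starlike_of_order lam =
     {f \<in> class_S. \<forall>z\<in>ball 0 1. Re (remove_sings (\<lambda>w. w * deriv f w / f w) z) > lam}"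

text \<open>
  The generalized Bernardi-Libera-Livingston operator, with the integral taken along the
  segment from \<open>0\<close> to \<open>z\<close>. All points of that segment other than \<open>0\<close> have
  the argument of \<open>z\<close>, so for \<open>t = s z\<close> with \<open>0 < s \<le> 1\<close> the principal powers satisfy
  \<open>t powr (c - 1) / z powr c = s powr (c - 1) / z\<close>, and the choice of branch is immaterial.
  For \<open>-1 < c < 0\<close> the integral is improper at \<open>0\<close> and exists as a
  Henstock-Kurzweil integral, which underlies \<open>contour_integral\<close>.
  At \<open>z = 0\<close> the right-hand side evaluates to \<open>0\<close>, as it should.
\<close>

definition bernardi_op :: "real \<Rightarrow> (complex \<Rightarrow> complex) \<Rightarrow> complex \<Rightarrow> complex" where
  "bernardi_op c f z =
     (of_real c + 1) / z powr of_real c *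
       contour_integral (linepath 0 z) (\<lambda>t. t powr (of_real c - 1) * f t)"

text \<open>
  The operator \<open>I\<^sup>\<sigma>\<close> for arbitrary real \<open>\<sigma>\<close>, by its power series
  \<open>z + (\<Sum>n\<ge>2. (2 / (n + 1)) powr \<sigma> * a\<^sub>n * z ^ n)\<close>, where the \<open>a\<^sub>n\<close> are the Taylor coefficients
  of \<open>f\<close> at \<open>0\<close>; the summation index is shifted by \<open>2\<close>.
\<close>

definition I_op :: "real \<Rightarrow> (complex \<Rightarrow> complex) \<Rightarrow> complex \<Rightarrow> complex" where
  "I_op \<sigma> f z =
     z + (\<Sum>n. of_real ((2 / (real (n + 2) + 1)) powr \<sigma>) *
               fps_nth (fps_expansion f 0) (n + 2) * z ^ (n + 2))"

definition starlike_bernardi :: "real \<Rightarrow> real \<Rightarrow> (complex \<Rightarrow> complex) set" where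
  "starlike_bernardi c lam = {f \<in> class_A. bernardi_op c f \<in> starlike_of_order lam}"

definition starlike_I :: "real \<Rightarrow> real \<Rightarrow> (complex \<Rightarrow> complex) set" where
  "starlike_I \<sigma> lam = {f \<in> class_A. I_op \<sigma> f \<in> starlike_of_order lam}"

end

(*
  Write g = I^sigma f = z k(z) and L_c g = z h(z), and put p = 1 + z h'/h.  From
  z h' + (c + 1) h = (c + 1) k one gets p + c = (c + 1) k / h, hence
  1 + z k'/k = p + z p' / (p + c).  At a point z0 of smallest modulus where Re p > lam fails,
  z0 p'(z0) is real and nonpositive, and Re (p(z0) + c) = lam + c >= 0, so the right-hand side
  has real part at most lam, contradicting the starlikeness of g.  The function h has no zero
  at z0 because |z h(z)| increases along the ray from 0 to z0.

  Univalence of F = z h(z): in logarithmic coordinates F becomes s + log h(exp s) on the left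
  half-plane, which is injective because its derivative p(exp s) has positive real part, and
  which commutes with the translation by 2 pi i.
*)
theory Submission
  imports Defs
begin

section \<open>Injectivity from a positive real part of the derivative\<close>

lemma has_real_derivative_Re_line:
  assumes "(P has_field_derivative D) (at (z + of_real t * d))"
  shows "((\<lambda>s. Re (P (z + of_real s * d))) has_real_derivative Re (D * d)) (at t)"
proof -
  have "((\<lambda>s. z + of_real s * d) has_vector_derivative d) (at t)"
    by (auto intro!: derivative_eq_intros)
  from field_vector_diff_chain_at[OF this assms]
  have "((\<lambda>s. P (z + of_real s * d)) has_vector_derivative d * D) (at t)"
    by (simp add: o_def)
  from bounded_linear.has_vector_derivative[OF bounded_linear_Re this]
  show ?thesis by (simp add: has_real_derivative_iff_has_vector_derivative mult.commute)
qed

lemma Re_mult_of_real: "Re (w * of_real r) = Re w * r"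
  by simp

text \<open>The Noshiro-Warschawski criterion. After multiplication of \<open>H\<close> by
  \<open>cnj (b - a)\<close>, the derivative along the segment from \<open>a\<close> to
  \<open>b\<close> has real part \<open>Re H'\<close> times \<open>(cmod (b - a))\<^sup>2\<close>,
  so the real part strictly increases and \<open>H a = H b\<close> is impossible.\<close>

lemma Re_deriv_pos_imp_inj_on:
  assumes "convex S"
    and der: "\<And>z. z \<in> S \<Longrightarrow> (H has_field_derivative H' z) (at z)"
    and pos: "\<And>z. z \<in> S \<Longrightarrow> Re (H' z) > 0"
  shows "inj_on H S"
proof (rule inj_onI, rule ccontr)
  fix a b assume ab: "a \<in> S" "b \<in> S" "H a = H b" "a \<noteq> b"
  define P where "P z = H z * cnj (b - a)" for z
  have dP: "(P has_field_derivative H' z * cnj (b - a)) (at z)" if "z \<in> S" for z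
    unfolding P_def using der[OF that] by (rule DERIV_cmult_right)
  have "Re (P (a + of_real 0 * (b - a))) < Re (P (a + of_real 1 * (b - a)))"
  proof (rule DERIV_pos_imp_increasing[of 0 1 "\<lambda>t. Re (P (a + of_real t * (b - a)))"])
    fix t :: real assume t: "0 \<le> t" "t \<le> 1"
    let ?w = "a + of_real t * (b - a)"
    have w: "?w = (1 - t) *\<^sub>R a + t *\<^sub>R b" by (simp add: scaleR_conv_of_real algebra_simps)
    have "?w \<in> S" unfolding w using convexD[OF assms(1) ab(1,2), of "1 - t" t] t by simp
    moreover have "Re (H' ?w * cnj (b - a) * (b - a)) = Re (H' ?w) * (cmod (b - a))\<^sup>2"
    proof -
      have "H' ?w * cnj (b - a) * (b - a) = H' ?w * of_real ((cmod (b - a))\<^sup>2)"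
        by (simp only: complex_norm_square mult_ac)
      then show ?thesis by (simp only: Re_mult_of_real)
    qed
    ultimately show "\<exists>y. ((\<lambda>t. Re (P (a + of_real t * (b - a)))) has_real_derivative y) (at t) \<and> 0 < y"
      using has_real_derivative_Re_line[OF dP] pos ab by (metis mult_pos_pos norm_eq_zero right_minus_eq zero_less_power2)
  qed simp
  then show False using ab by (simp add: P_def)
qed

lemma Re_log_deriv_pos_imp_inj_on:
  assumes h: "h holomorphic_on ball 0 1" and nz: "\<And>z. z \<in> ball 0 1 \<Longrightarrow> h z \<noteq> 0"
    and pos: "\<And>z. z \<in> ball 0 1 \<Longrightarrow> Re (1 + z * deriv h z / h z) > 0"
  shows "inj_on (\<lambda>z. z * h z) (ball 0 1)"
proof -
  obtain L where L: "L holomorphic_on ball 0 1" "\<And>z. z \<in> ball 0 1 \<Longrightarrow> exp (L z) = h z"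
    using contractible_imp_holomorphic_log[OF h convex_imp_contractible[OF convex_ball]] nz by metis
  have dL: "(L has_field_derivative deriv h z / h z) (at z)" if z: "z \<in> ball 0 1" for z
  proof -
    have d: "(L has_field_derivative deriv L z) (at z)"
      using L(1) z holomorphic_derivI open_ball by blast
    have "((\<lambda>z. exp (L z)) has_field_derivative exp (L z) * deriv L z) (at z)"
      using d by (rule DERIV_chain2[OF DERIV_exp])
    then have "(h has_field_derivative exp (L z) * deriv L z) (at z)"
      by (rule has_field_derivative_transform_within_open[where S="ball 0 1"]) (use z L in auto)
    then have "deriv h z = h z * deriv L z" using L(2)[OF z] by (simp add: DERIV_imp_deriv)
    then have "deriv L z = deriv h z / h z" using nz[OF z] by simp
    with d show ?thesis by simp
  qed
  \<comment> \<open>\<open>H s\<close> is a logarithm of \<open>z * h z\<close> at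
    \<open>z = exp s\<close>, and its derivative is the given expression
    \<open>1 + z * deriv h z / h z\<close> at that point.\<close>
  define H where "H s = s + L (exp s)" for s
  have inH: "inj_on H {s. Re s < 0}"
  proof (rule Re_deriv_pos_imp_inj_on)
    show "convex {s. Re s < 0}" by (rule convex_halfspace_Re_lt)
  next
    fix s assume "s \<in> {s. Re s < 0}"
    then have s: "exp s \<in> ball 0 1" by simp
    show "(H has_field_derivative 1 + exp s * deriv h (exp s) / h (exp s)) (at s)"
      unfolding H_def
      by (rule derivative_eq_intros DERIV_chain2[OF dL[OF s] DERIV_exp] refl | simp)+
    show "Re (1 + exp s * deriv h (exp s) / h (exp s)) > 0" using pos[OF s] .
  qed
  show ?thesis
  proof (rule inj_onI)
    fix a b :: complex assume a: "a \<in> ball 0 1" and b: "b \<in> ball 0 1" and eq: "a * h a = b * h b"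
    show "a = b"
    \<comment> \<open>The origin has no logarithm; since \<open>h\<close> is zero-free, it is the
      only zero of \<open>z * h z\<close> in the disc.\<close>
    proof (cases "a = 0 \<or> b = 0")
      case True then show ?thesis using eq nz[OF a] nz[OF b] by auto
    next
      case False
      define s t where "s = Ln a" and "t = Ln b"
      have st: "exp s = a" "exp t = b" using False by (auto simp: s_def t_def)
      have "exp (H s) = exp (H t)" using eq L a b by (simp add: H_def exp_add st)
      then obtain n :: int where n: "H s = H t + (of_int (2 * n) * pi) * \<i>" by (auto simp: exp_eq)
      \<comment> \<open>The multiple of the period is absorbed into the argument:
        \<open>exp\<close>, and hence \<open>L (exp t)\<close>, does not change, while
        \<open>H\<close> moves by exactly the shift. The real part is unchanged too, so
        \<open>t'\<close> stays in the half-plane.\<close>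
      define t' where "t' = t + (of_int (2 * n) * pi) * \<i>"
      have et': "exp t' = b" using st exp_eq[of t' t] unfolding t'_def by auto
      have "H s = H t'" using n st et' by (simp add: H_def t'_def)
      moreover have "Re s < 0" "Re t' < 0"
        using a b st et' by (metis dist_0_norm exp_less_one_iff mem_ball norm_exp_eq_Re)+
      ultimately have "s = t'" using inH by (auto dest: inj_onD)
      then show ?thesis using st et' by simp
    qed
  qed
qed

section \<open>The differential equation behind the Bernardi operator\<close>

lemma holomorphic_factor_z:
  fixes g :: "complex \<Rightarrow> complex"
  assumes "g holomorphic_on ball 0 1" "g 0 = 0"
  obtains k where "k holomorphic_on ball 0 1" "\<And>z. g z = z * k z" "k 0 = deriv g 0"
proof
  show "(\<lambda>z. if z = 0 then deriv g 0 else (g z - g 0) / (z - 0)) holomorphic_on ball 0 1"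
    by (rule pole_lemma[OF assms(1)]) simp
qed (use assms in auto)

text \<open>Comparing coefficients turns the equation into (n + c + 1) b_n = (c + 1) a_n. For c > -1
  this is solvable for every n, and the multipliers lie in (0, 1], so the series for
  \<open>h\<close> converges wherever that of \<open>k\<close> converges absolutely.\<close>

lemma bernardi_ode_solution_exists:
  fixes k :: "complex \<Rightarrow> complex" and c :: real
  assumes k: "k holomorphic_on ball 0 1" and c: "c > -1"
  obtains h where "h holomorphic_on ball 0 1" "h 0 = k 0"
    "\<And>z. z \<in> ball 0 1 \<Longrightarrow> z * deriv h z + (of_real c + 1) * h z = (of_real c + 1) * k z"
proof -
  define a where "a n = (deriv ^^ n) k 0 / fact n" for n
  define b where "b n = of_real ((c + 1) / (real n + c + 1)) * a n" for n
  have ka: "(\<lambda>n. a n * z ^ n) sums k z" if "norm z < 1" for z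
    using holomorphic_power_series[OF k, of z] that by (simp add: a_def)
  define h where "h z = (\<Sum>n. b n * z ^ n)" for z
  have hb: "(\<lambda>n. b n * z ^ n) sums h z" if z: "norm z < 1" for z
  proof -
    \<comment> \<open>Convergence at the larger radius \<open>r\<close> gives the absolute
      convergence at \<open>z\<close> that the comparison needs.\<close>
    obtain r where r: "norm z < r" "r < 1" using dense[OF z] by blast
    have "0 < r" using r(1) norm_ge_zero[of z] by linarith
    then have "norm (of_real r :: complex) < 1" using r by simp
    from powser_insidea[OF sums_summable[OF ka[OF this]], of z]
    have "summable (\<lambda>n. norm (a n * z ^ n))" using r \<open>0 < r\<close> by simp
    moreover have "norm (b n * z ^ n) \<le> norm (a n * z ^ n)" for n
    proof -
      have "\<bar>(c + 1) / (real n + c + 1)\<bar> \<le> 1" using c by (simp add: field_simps)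
      then show ?thesis unfolding b_def norm_mult norm_of_real mult.assoc
        by (intro mult_left_le_one_le) auto
    qed
    ultimately have "summable (\<lambda>n. b n * z ^ n)" by (rule summable_comparison_test'[where N=0])
    then show ?thesis unfolding h_def by (rule summable_sums)
  qed
  show ?thesis
  proof
    show hol: "h holomorphic_on ball 0 1"
      by (rule power_series_holomorphic[of _ _ b]) (use hb in auto)
    have "b 0 = a 0" using c by (simp add: b_def)
    then show "h 0 = k 0" by (simp add: h_def a_def)
    fix z :: complex assume z: "z \<in> ball 0 1"
    then have nz: "norm z < 1" by simp
    have "(h has_field_derivative deriv h z) (at z)" using hol z holomorphic_derivI open_ball by blast
    from termdiffs_sums_strong[OF hb this nz]
    have "(\<lambda>n. diffs b n * z ^ n) sums deriv h z" by simp
    from sums_mult[OF this, of z] have "(\<lambda>n. of_nat (Suc n) * b (Suc n) * z ^ Suc n) sums (z * deriv h z)"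
      by (simp add: diffs_def algebra_simps)
    \<comment> \<open>The factor \<open>of_nat n\<close> vanishes at n = 0, so undoing the index
      shift adds no term.\<close>
    from sums_Suc[of "\<lambda>n. of_nat n * b n * z ^ n", OF this]
    have "(\<lambda>n. of_nat n * b n * z ^ n) sums (z * deriv h z)" by simp
    from sums_add[OF this sums_mult[OF hb[OF nz], of "of_real c + 1"]]
    have "(\<lambda>n. of_nat n * b n * z ^ n + (of_real c + 1) * (b n * z ^ n))
             sums (z * deriv h z + (of_real c + 1) * h z)" .
    moreover have "of_nat n * b n * z ^ n + (of_real c + 1) * (b n * z ^ n) = (of_real c + 1) * (a n * z ^ n)" for n
    proof -
      have "of_nat n * b n * z ^ n + (of_real c + 1) * (b n * z ^ n) = of_real (real n + c + 1) * b n * z ^ n"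
        by (simp add: algebra_simps)
      also have "of_real (real n + c + 1) * b n = of_real ((real n + c + 1) * ((c + 1) / (real n + c + 1))) * a n"
        unfolding b_def by (simp only: of_real_mult mult.assoc)
      also have "(real n + c + 1) * ((c + 1) / (real n + c + 1)) = c + 1" using c by simp
      finally show ?thesis by (simp add: algebra_simps)
    qed
    ultimately show "z * deriv h z + (of_real c + 1) * h z = (of_real c + 1) * k z"
      using sums_unique2[OF _ sums_mult[OF ka[OF nz], of "of_real c + 1"]] by simp
  qed
qed

text \<open>Put t = s z with s in [0,1]. Up to a constant the integrand is then s^c (c + 1) k(s z),
  which by the equation is the derivative of s^(c+1) h(s z) in s.\<close>

lemma bernardi_op_eq:
  fixes h k :: "complex \<Rightarrow> complex" and c :: real
  assumes h: "h holomorphic_on ball 0 1" and c: "c > -1"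
    and ode: "\<And>z. z \<in> ball 0 1 \<Longrightarrow> z * deriv h z + (of_real c + 1) * h z = (of_real c + 1) * k z"
    and g: "\<And>z. z \<in> ball 0 1 \<Longrightarrow> g z = z * k z"
    and z: "z \<in> ball 0 1"
  shows "bernardi_op c g z = z * h z"
proof (cases "z = 0")
  case True then show ?thesis by (simp add: bernardi_op_def)
next
  case False
  have sz: "of_real s * z \<in> ball 0 1" if "s \<in> {0..1}" for s :: real
    using z that mult_left_le_one_le[of "norm z" s] by (simp add: norm_mult)
  define f where "f s = of_real (s powr (c + 1)) * h (of_real s * z)" for s
  have "((\<lambda>s. of_real (s powr c) * ((of_real c + 1) * k (of_real s * z))) has_integral (f 1 - f 0)) {0..1}"
  \<comment> \<open>For -1 < c < 0 the power s^(c+1) is not differentiable at 0, but c + 1 > 0 makes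
    it continuous there, so the derivative is taken only in the open interval.\<close>
  proof (rule fundamental_theorem_of_calculus_interior)
    have "continuous_on {0..1} (\<lambda>s. s powr (c + 1))"
      by (rule continuous_on_powr') (use c in \<open>auto intro!: continuous_intros\<close>)
    then show "continuous_on {0..1} f" unfolding f_def
      by (intro continuous_on_mult continuous_on_of_real continuous_on_id continuous_on_const
           continuous_on_compose2[OF holomorphic_on_imp_continuous_on[OF h]])
         (use sz in auto)
  next
    fix s :: real assume s: "s \<in> {0<..<1}"
    then have sb: "of_real s * z \<in> ball 0 1" by (intro sz) auto
    have dh: "(h has_field_derivative deriv h (of_real s * z)) (at (of_real s * z))"
      using h sb holomorphic_derivI open_ball by blast
    have "((\<lambda>s. of_real s * z) has_vector_derivative z) (at s)"
      by (auto intro!: derivative_eq_intros)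
    from field_vector_diff_chain_at[OF this dh]
    have d1: "((\<lambda>s. h (of_real s * z)) has_vector_derivative z * deriv h (of_real s * z)) (at s)"
      by (simp add: o_def)
    have "((\<lambda>s. s powr (c + 1)) has_real_derivative (c + 1) * s powr c) (at s)"
      using has_real_derivative_powr[of s "c + 1"] s by simp
    from has_vector_derivative_of_real[OF this]
    have d2: "((\<lambda>s. complex_of_real (s powr (c + 1))) has_vector_derivative of_real ((c + 1) * s powr c)) (at s)" .
    have "s powr (c + 1) = s powr c * s" using s by (simp add: powr_add)
    then have *: "of_real (s powr (c + 1)) * (z * deriv h (of_real s * z)) + of_real ((c + 1) * s powr c) * h (of_real s * z)
       = of_real (s powr c) * (of_real s * z * deriv h (of_real s * z) + (of_real c + 1) * h (of_real s * z))"
      by (simp add: algebra_simps)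
    show "(f has_vector_derivative of_real (s powr c) * ((of_real c + 1) * k (of_real s * z))) (at s)"
      unfolding f_def using has_vector_derivative_mult[OF d2 d1] unfolding * ode[OF sb] .
  qed simp
  moreover have "f 0 = 0" "f 1 = h z" using c by (simp_all add: f_def)
  ultimately have "((\<lambda>s. of_real (s powr c) * ((of_real c + 1) * k (of_real s * z))) has_integral h z) {0..1}"
    by simp
  \<comment> \<open>This constant collects the powers of \<open>z\<close> from the substitution and
    cancels the prefactor of the operator up to one factor \<open>z\<close>.\<close>
  from has_integral_mult_right[OF this, of "z powr of_real c * z / (of_real c + 1)"]
  have I: "((\<lambda>s. z powr of_real c * z / (of_real c + 1) * (of_real (s powr c) * ((of_real c + 1) * k (of_real s * z)))) has_integral
      z powr of_real c * z / (of_real c + 1) * h z) {0..1}" .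
  have c1: "of_real c + 1 \<noteq> (0::complex)"
    using c by (metis add.commute add_eq_0_iff less_irrefl of_real_1 of_real_eq_iff of_real_minus)
  have zc: "z powr of_real c \<noteq> 0" using False by simp
  have "((\<lambda>s. linepath 0 z s powr (of_real c - 1) * g (linepath 0 z s) * (z - 0)) has_integral
      z powr of_real c * z / (of_real c + 1) * h z) {0..1}"
  \<comment> \<open>Discarding the endpoint leaves s > 0, where the principal powers of s z split
    and the exponent laws apply.\<close>
  proof (rule has_integral_spike_finite[OF _ _ I, of "{0}"])
    fix s :: real assume s: "s \<in> {0..1} - {0}"
    have l: "linepath 0 z s = of_real s * z" by (simp add: linepath_def scaleR_conv_of_real)
    have p: "(of_real s * z) powr (of_real c - 1) = of_real (s powr (c - 1)) * z powr (of_real c - 1)"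
      using s powr_of_real[of s "c - 1"] by (subst powr_times_real_left) auto
    have q: "z powr (of_real c - 1) * z = z powr of_real c" using False by (simp add: powr_diff)
    have r: "s powr (c - 1) * s = s powr c" using s by (simp add: powr_diff)
    have gz: "g (of_real s * z) = of_real s * z * k (of_real s * z)" using g sz s by auto
    have "linepath 0 z s powr (of_real c - 1) * g (linepath 0 z s) * (z - 0) =
       of_real (s powr (c - 1) * s) * (z powr (of_real c - 1) * z) * k (of_real s * z) * z"
      unfolding l p gz by simp
    also have "\<dots> = z powr of_real c * z / (of_real c + 1) * (of_real (s powr c) * ((of_real c + 1) * k (of_real s * z)))"
      unfolding q r using c1 by simp
    finally show "linepath 0 z s powr (of_real c - 1) * g (linepath 0 z s) * (z - 0) = \<dots>" .
  qed simp
  then have "contour_integral (linepath 0 z) (\<lambda>t. t powr (of_real c - 1) * g t) = z powr of_real c * z / (of_real c + 1) * h z"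
    by (intro contour_integral_unique) (simp add: has_contour_integral_linepath)
  then show ?thesis unfolding bernardi_op_def using c1 zc by simp
qed

section \<open>First contact with the boundary of a half-plane\<close>

lemma Re_mult_halfplane_imp_nonpos_real:
  fixes A :: complex
  assumes "\<And>e. Re e < 0 \<Longrightarrow> 0 \<le> Re (A * e)"
  shows "Im A = 0" "Re A \<le> 0"
proof -
  show "Im A = 0"
  proof (rule ccontr)
    assume "Im A \<noteq> 0"
    \<comment> \<open>The imaginary part is chosen so that \<open>Re (A * e) = -1\<close>.\<close>
    then show False using assms[of "Complex (-1) ((1 - Re A) / Im A)"] by simp
  qed
  show "Re A \<le> 0" using assms[of "-1"] by simp
qed

text \<open>A first-order lemma of Jack type. Every direction \<open>z * e\<close> with
  \<open>Re e < 0\<close> enters the disc of radius \<open>norm z\<close>, where \<open>Re P\<close>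
  is no smaller than at \<open>z\<close>; hence the derivative \<open>Re (z * D * e)\<close> is
  nonnegative for all such \<open>e\<close>.\<close>

lemma Re_boundary_min_imp_radial_deriv_nonpos:
  fixes P :: "complex \<Rightarrow> complex"
  assumes dP: "(P has_field_derivative D) (at z)" and "z \<noteq> 0"
    and min: "\<And>w. norm w < norm z \<Longrightarrow> Re (P z) \<le> Re (P w)"
  shows "Im (z * D) = 0" "Re (z * D) \<le> 0"
proof -
  have *: "0 \<le> Re (z * D * e)" if e: "Re e < 0" for e
  proof (rule ccontr)
    assume neg: "\<not> 0 \<le> Re (z * D * e)"
    have d: "((\<lambda>s. Re (P (z + of_real s * (z * e)))) has_real_derivative Re (D * (z * e))) (at 0)"
      by (rule has_real_derivative_Re_line) (use dP in simp)
    have "Re (D * (z * e)) < 0" using neg by (simp add: mult_ac)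
    from DERIV_neg_dec_right[OF d this] obtain \<epsilon> where \<epsilon>: "\<epsilon> > 0"
      "\<And>s. 0 < s \<Longrightarrow> s < \<epsilon> \<Longrightarrow> Re (P (z + of_real s * (z * e))) < Re (P z)" by auto
    have n: "norm e > 0" using e by auto
    \<comment> \<open>The second bound on s makes |1 + s e|^2 = 1 + s (2 Re e + s |e|^2) less than
      1, so the step stays inside the disc.\<close>
    have "min \<epsilon> (- 2 * Re e / (norm e)\<^sup>2) > 0" using \<epsilon>(1) e n
      by (intro min_less_iff_conj[THEN iffD2] conjI divide_pos_pos) auto
    then obtain s where "0 < s" "s < min \<epsilon> (- 2 * Re e / (norm e)\<^sup>2)" using dense by blast
    then have s: "0 < s" "s < \<epsilon>" "s * (norm e)\<^sup>2 < - 2 * Re e" using n by (auto simp: field_simps)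
    have "(norm (1 + of_real s * e))\<^sup>2 = 1 + s * (2 * Re e + s * (norm e)\<^sup>2)"
      unfolding cmod_power2 by (simp add: power2_eq_square algebra_simps)
    also have "\<dots> < 1" using s by (simp add: mult_pos_neg)
    finally have "norm (1 + of_real s * e) < 1" by (simp add: power2_less_imp_less abs_square_less_1)
    then have "norm z * norm (1 + of_real s * e) < norm z" using \<open>z \<noteq> 0\<close> by simp
    moreover have "z + of_real s * (z * e) = z * (1 + of_real s * e)" by (simp add: algebra_simps)
    ultimately have "norm (z + of_real s * (z * e)) < norm z" by (simp add: norm_mult)
    from min[OF this] \<epsilon>(2)[OF s(1,2)] show False by simp
  qed
  show "Im (z * D) = 0" "Re (z * D) \<le> 0" using Re_mult_halfplane_imp_nonpos_real[OF *] by blast+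
qed

text \<open>With w = t z, t times the t-derivative of |F(w)|^2 is 2 Re (w F'(w) cnj F(w)). The
  condition multiplies by \<open>cnj (F ...)\<close> instead of dividing by \<open>F\<close>, so it
  makes sense even at zeros of \<open>F\<close>.\<close>

lemma norm_nondecreasing_on_ray:
  fixes F :: "complex \<Rightarrow> complex"
  assumes hol: "F holomorphic_on S" "open S" and ab: "0 < a" "a \<le> b"
    and S: "\<And>t. a \<le> t \<Longrightarrow> t \<le> b \<Longrightarrow> of_real t * z \<in> S"
    and pos: "\<And>t. a < t \<Longrightarrow> t < b \<Longrightarrow>
       0 \<le> Re (of_real t * z * deriv F (of_real t * z) * cnj (F (of_real t * z)))"
  shows "norm (F (of_real a * z)) \<le> norm (F (of_real b * z))"
proof -
  have "(norm (F (of_real a * z)))\<^sup>2 \<le> (norm (F (of_real b * z)))\<^sup>2"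
    unfolding cmod_power2
  proof (rule DERIV_nonneg_imp_increasing_open[OF ab(2)])
    have "continuous_on {a..b} (\<lambda>t. F (of_real t * z))"
      by (rule continuous_on_compose2[OF holomorphic_on_imp_continuous_on[OF hol(1)]])
         (use S in \<open>auto intro!: continuous_intros\<close>)
    then show "continuous_on {a..b} (\<lambda>t. (Re (F (of_real t * z)))\<^sup>2 + (Im (F (of_real t * z)))\<^sup>2)"
      by (intro continuous_intros)
  next
    fix t assume t: "a < t" "t < b"
    let ?w = "of_real t * z"
    have d: "(F has_field_derivative deriv F ?w) (at (0 + ?w))"
      using hol S[of t] t holomorphic_derivI by fastforce
    have d1: "((\<lambda>t. Re (F (of_real t * z))) has_real_derivative Re (deriv F ?w * z)) (at t)"
      using has_real_derivative_Re_line[OF d] by simp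
    have d2: "((\<lambda>t. Im (F (of_real t * z))) has_real_derivative Im (deriv F ?w * z)) (at t)"
      \<comment> \<open>The imaginary part of \<open>F\<close> is the real part of
        \<open>-\<i> * F\<close>.\<close>
      using has_real_derivative_Re_line[OF DERIV_cmult[OF d, of "-\<i>"]] by (simp add: algebra_simps)
    let ?D = "2 * Re (F ?w) * Re (deriv F ?w * z) + 2 * Im (F ?w) * Im (deriv F ?w * z)"
    have "((\<lambda>t. (Re (F (of_real t * z)))\<^sup>2 + (Im (F (of_real t * z)))\<^sup>2) has_real_derivative ?D) (at t)"
      by (rule derivative_eq_intros d1 d2 refl)+ simp
    moreover have "t * ?D = 2 * Re (?w * deriv F ?w * cnj (F ?w))"
      by (simp add: algebra_simps)
    then have "0 \<le> t * ?D" using pos[OF t] by simp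
    then have "0 \<le> ?D" using t ab by (simp add: zero_le_mult_iff)
    ultimately show "\<exists>y. ((\<lambda>t. (Re (F (of_real t * z)))\<^sup>2 + (Im (F (of_real t * z)))\<^sup>2) has_real_derivative y) (at t) \<and> 0 \<le> y"
      by blast
  qed
  then show ?thesis by (rule power2_le_imp_le) simp
qed

lemma bernardi_preserves_log_deriv_bound:
  fixes h k :: "complex \<Rightarrow> complex" and c lam :: real
  assumes h: "h holomorphic_on ball 0 1" and k: "k holomorphic_on ball 0 1" and h0: "h 0 = 1"
    and ode: "\<And>z. z \<in> ball 0 1 \<Longrightarrow> z * deriv h z + (of_real c + 1) * h z = (of_real c + 1) * k z"
    and nz: "\<And>z. z \<in> ball 0 1 \<Longrightarrow> k z \<noteq> 0"
    and q: "\<And>z. z \<in> ball 0 1 \<Longrightarrow> Re (1 + z * deriv k z / k z) > lam"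
    and c: "c > -1" "- lam \<le> c" and lam: "0 \<le> lam" "lam < 1"
    and b: "b \<in> ball 0 1"
  shows "h b \<noteq> 0 \<and> Re (1 + b * deriv h b / h b) > lam"
proof -
  \<comment> \<open>Clearing the denominator: \<open>\<Psi> z > 0\<close> also excludes \<open>h z = 0\<close>, and the set where it fails is relatively closed.\<close>
  define \<Psi> where "\<Psi> z = Re ((h z + z * deriv h z) * cnj (h z)) - lam * (norm (h z))\<^sup>2" for z
  have \<Psi>_eq: "\<Psi> z = (norm (h z))\<^sup>2 * (Re (1 + z * deriv h z / h z) - lam)" if "h z \<noteq> 0" for z
  proof -
    define p where "p = 1 + z * deriv h z / h z"
    have "h z + z * deriv h z = p * h z" using that by (simp add: p_def field_simps)
    then have "(h z + z * deriv h z) * cnj (h z) = p * of_real ((norm (h z))\<^sup>2)"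
      unfolding complex_norm_square by (simp add: mult.assoc)
    then show ?thesis unfolding \<Psi>_def p_def[symmetric]
      by (simp only: Re_mult_of_real) (simp add: algebra_simps)
  qed
  have \<Psi>_pos: "\<Psi> z > 0 \<longleftrightarrow> h z \<noteq> 0 \<and> Re (1 + z * deriv h z / h z) > lam" for z
  proof (cases "h z = 0")
    case True then show ?thesis by (simp add: \<Psi>_def)
  next
    case False then show ?thesis unfolding \<Psi>_eq[OF False] by (simp add: zero_less_mult_iff)
  qed
  have dh: "deriv h holomorphic_on ball 0 1" using h by (intro holomorphic_deriv) auto
  have \<Psi>_cont: "continuous_on (ball 0 1) \<Psi>" unfolding \<Psi>_def
    using h dh by (intro continuous_intros holomorphic_on_imp_continuous_on)
  have "\<Psi> b > 0"
  proof (rule ccontr)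
    assume bad: "\<not> \<Psi> b > 0"
    \<comment> \<open>Restricting the bad set to a closed disc inside the unit disc makes it
      compact, so it has a point of least modulus.\<close>
    define K where "K = {z \<in> cball 0 (norm b). \<Psi> z \<le> 0}"
    have sub: "cball 0 (norm b) \<subseteq> ball 0 1" using b by auto
    have "compact K"
    proof -
      have "closed (cball 0 (norm b) \<inter> \<Psi> -` {..0})"
        by (intro continuous_closed_preimage continuous_on_subset[OF \<Psi>_cont sub]) auto
      then have "compact (cball 0 (norm b) \<inter> (cball 0 (norm b) \<inter> \<Psi> -` {..0}))"
        by (intro compact_Int_closed) auto
      then show ?thesis by (rule back_subst[of compact]) (auto simp: K_def)
    qed
    moreover have "K \<noteq> {}" using bad by (auto simp: K_def not_less intro!: exI[of _ b])
    moreover have "continuous_on K norm" by (intro continuous_intros)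
    ultimately obtain z where z: "z \<in> K" "\<And>w. w \<in> K \<Longrightarrow> norm z \<le> norm w"
      using continuous_attains_inf by metis
    have zb: "z \<in> ball 0 1" and \<Psi>z: "\<Psi> z \<le> 0" using z b by (auto simp: K_def)
    have inside: "\<Psi> w > 0" if "norm w < norm z" for w
    proof (rule ccontr)
      assume "\<not> \<Psi> w > 0"
      then have "w \<in> K" using that z(1) by (auto simp: K_def)
      from z(2)[OF this] that show False by simp
    qed
    have "\<Psi> 0 > 0" using h0 lam by (simp add: \<Psi>_def)
    then have z0: "z \<noteq> 0" using \<Psi>z by auto
    have hz: "h z \<noteq> 0"
    proof -
      let ?F = "\<lambda>w. w * h w"
      \<comment> \<open>Any start strictly between 0 and \<open>z\<close> would do:
        \<open>\<Psi>\<close> is positive there, so \<open>?F\<close> is nonzero, and monotonicity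
        carries this to \<open>z\<close>.\<close>
      have "norm (?F (of_real (1/2) * z)) \<le> norm (?F (of_real 1 * z))"
      proof (rule norm_nondecreasing_on_ray[of ?F "ball 0 1" "1/2" 1 z])
        show "?F holomorphic_on ball 0 1" using h by (intro holomorphic_intros)
      next
        fix t :: real assume t: "1/2 \<le> t" "t \<le> 1"
        then show "of_real t * z \<in> ball 0 1"
          using zb mult_left_le_one_le[of "norm z" t] by (simp add: norm_mult)
      next
        fix t :: real assume t: "1/2 < t" "t < 1"
        let ?w = "of_real t * z"
        have wz: "norm ?w < norm z" using t z0 by (simp add: norm_mult)
        then have w: "?w \<in> ball 0 1" using zb by simp
        have "(h has_field_derivative deriv h ?w) (at ?w)"
          using h w holomorphic_derivI open_ball by blast
        from DERIV_mult[OF DERIV_ident this] have "deriv ?F ?w = h ?w + ?w * deriv h ?w"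
          by (simp add: DERIV_imp_deriv)
        \<comment> \<open>Pulling out |w|^2 leaves the first term of \<open>\<Psi>\<close>,
          nonnegative because \<open>\<Psi>\<close> is positive inside and lam is
          nonnegative.\<close>
        then have "Re (?w * deriv ?F ?w * cnj (?F ?w)) = Re ((h ?w + ?w * deriv h ?w) * cnj (h ?w) * of_real ((norm ?w)\<^sup>2))"
          unfolding complex_norm_square by (simp only: complex_cnj_mult mult_ac)
        also have "\<dots> = (\<Psi> ?w + lam * (norm (h ?w))\<^sup>2) * (norm ?w)\<^sup>2" by (simp add: \<Psi>_def)
        also have "\<dots> \<ge> 0"
          using inside[OF wz] lam by simp
        finally show "0 \<le> Re (?w * deriv ?F ?w * cnj (?F ?w))" .
      qed auto
      moreover have "h (of_real (1/2) * z) \<noteq> 0"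
        using inside[of "of_real (1/2) * z"] \<Psi>_pos z0 by (auto simp: norm_mult)
      ultimately show ?thesis using z0 by auto
    qed
    define P where "P w = 1 + w * deriv h w / h w" for w
    have dhz: "(h has_field_derivative deriv h z) (at z)"
      using h zb holomorphic_derivI open_ball by blast
    have ddhz: "(deriv h has_field_derivative deriv (deriv h) z) (at z)"
      using dh zb holomorphic_derivI open_ball by blast
    have dkz: "(k has_field_derivative deriv k z) (at z)"
      using k zb holomorphic_derivI open_ball by blast
    obtain D where D: "(P has_field_derivative D) (at z)"
    proof -
      have "((\<lambda>w. 1 + w * deriv h w / h w) has_field_derivative
         ((deriv h z + z * deriv (deriv h) z) * h z - z * deriv h z * deriv h z) / (h z * h z)) (at z)"
        by (rule derivative_eq_intros dhz ddhz refl hz | simp)+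
      then show ?thesis using that unfolding P_def by blast
    qed
    have P_inside: "Re (P w) > lam" if "norm w < norm z" for w
      using inside[OF that] \<Psi>_pos[of w] by (simp add: P_def)
    \<comment> \<open>The radial limit gives one inequality and \<open>\<Psi> z \<le> 0\<close> the
      other, so contact occurs exactly on the line Re = lam.\<close>
    have "Re (P z) \<ge> lam"
    proof -
      have "((\<lambda>s. Re (P (0 + of_real s * z))) has_real_derivative Re (D * z)) (at 1)"
        by (rule has_real_derivative_Re_line) (use D in simp)
      then have "isCont (\<lambda>s. Re (P (of_real s * z))) 1" using DERIV_isCont by simp blast
      then have lim: "((\<lambda>s. Re (P (of_real s * z))) \<longlongrightarrow> Re (P z)) (at_left 1)"
        by (simp add: isCont_def filterlim_at_split)
      have "eventually (\<lambda>s::real. s \<in> {0<..<1}) (at_left 1)"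
        by (rule eventually_at_leftI) auto
      then have "eventually (\<lambda>s. lam \<le> Re (P (of_real s * z))) (at_left 1)"
      proof eventually_elim
        case (elim s)
        then have "norm (of_real s * z) < norm z" using z0 by (simp add: norm_mult)
        from P_inside[OF this] show ?case by simp
      qed
      with lim show ?thesis by (rule tendsto_lowerbound) simp
    qed
    moreover have "Re (P z) \<le> lam" using \<Psi>z \<Psi>_pos[of z] hz unfolding P_def by linarith
    ultimately have RePz: "Re (P z) = lam" by simp
    have "Re (P z) \<le> Re (P w)" if "norm w < norm z" for w
      using P_inside[OF that] RePz by simp
    note A = Re_boundary_min_imp_radial_deriv_nonpos[OF D z0 this]
    have c1: "of_real c + 1 \<noteq> (0::complex)"
      using c by (metis add.commute add_eq_0_iff less_irrefl of_real_1 of_real_eq_iff of_real_minus)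
    have e1: "h z * (P z + of_real c) = (of_real c + 1) * k z"
      using ode[OF zb] hz by (simp add: P_def field_simps)
    then have Pc: "P z + of_real c \<noteq> 0" using nz[OF zb] c1 by auto
    have "((\<lambda>w. h w * (P w + of_real c)) has_field_derivative deriv h z * (P z + of_real c) + D * h z) (at z)"
      by (rule derivative_eq_intros dhz D refl | simp)+
    moreover have "((\<lambda>w. h w * (P w + of_real c)) has_field_derivative (of_real c + 1) * deriv k z) (at z)"
    \<comment> \<open>The identity \<open>e1\<close> holds wherever \<open>h\<close> is nonzero,
      hence on a neighbourhood of \<open>z\<close>, and may be differentiated there.\<close>
    proof (rule has_field_derivative_transform_within_open[OF DERIV_cmult[OF dkz]])
      show "open (ball 0 1 \<inter> h -` (- {0}))"
        by (rule continuous_open_preimage) (use h holomorphic_on_imp_continuous_on in auto)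
    next
      fix w assume w: "w \<in> ball 0 1 \<inter> h -` (- {0})"
      then show "(of_real c + 1) * k w = h w * (P w + of_real c)"
        using ode[of w, symmetric] by (simp add: P_def field_simps)
    qed (use zb hz in auto)
    ultimately have e2: "deriv h z * (P z + of_real c) + D * h z = (of_real c + 1) * deriv k z"
      by (rule DERIV_unique)
    \<comment> \<open>Dividing \<open>e2\<close> by \<open>e1\<close> is logarithmic differentiation
      of the product \<open>h * (P + c)\<close>.\<close>
    have "z * deriv k z / k z = z * ((of_real c + 1) * deriv k z) / ((of_real c + 1) * k z)" using c1 by simp
    also have "\<dots> = z * (deriv h z * (P z + of_real c) + D * h z) / (h z * (P z + of_real c))"
      unfolding e1 e2 ..
    also have "\<dots> = (P z - 1) + z * D / (P z + of_real c)"
      unfolding P_def using hz Pc[unfolded P_def] by (simp add: divide_simps) (simp add: algebra_simps)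
    finally have "1 + z * deriv k z / k z = P z + z * D / (P z + of_real c)" by simp
    \<comment> \<open>As \<open>z * D\<close> is real, only the real part lam + c of the denominator
      enters; its sign is where \<open>-lam \<le> c\<close> is used.\<close>
    moreover have "Re (z * D / (P z + of_real c)) = Re (z * D) * (lam + c) / (norm (P z + of_real c))\<^sup>2"
      using A(1) RePz by (simp add: Re_divide cmod_power2)
    moreover have "\<dots> \<le> 0" using A(2) c
      by (intro divide_nonpos_nonneg mult_nonpos_nonneg) auto
    ultimately show False using q[OF zb] RePz by simp
  qed
  then show ?thesis by (simp add: \<Psi>_pos)
qed

section \<open>Starlikeness in terms of the factor \<open>k\<close> in
  \<open>g z = z * k z\<close>\<close>

text \<open>Off the origin the quotient equals 1 + w k'/k, which is continuous on the whole disc;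
  its limit is therefore the filled-in value, at 0 as elsewhere.\<close>

lemma remove_sings_log_deriv:
  assumes k: "k holomorphic_on ball 0 1" and nz: "\<And>w. w \<in> ball 0 1 \<Longrightarrow> k w \<noteq> 0"
    and g: "\<And>w. w \<in> ball 0 1 \<Longrightarrow> g w = w * k w" and z: "z \<in> ball 0 1"
  shows "remove_sings (\<lambda>w. w * deriv g w / g w) z = 1 + z * deriv k z / k z"
proof (rule remove_sings_eqI)
  have "deriv k holomorphic_on ball 0 1" using k by (intro holomorphic_deriv) auto
  then have "continuous_on (ball 0 1) (\<lambda>w. 1 + w * deriv k w / k w)"
    using k nz by (intro continuous_intros holomorphic_on_imp_continuous_on) auto
  then have "((\<lambda>w. 1 + w * deriv k w / k w) \<longlongrightarrow> 1 + z * deriv k z / k z) (at z)"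
    using z by (simp add: continuous_on_eq_continuous_at isCont_def)
  moreover have "eventually (\<lambda>w. 1 + w * deriv k w / k w = w * deriv g w / g w) (at z)"
  proof -
    have "eventually (\<lambda>w. w \<in> ball 0 1) (at z)" using z by (intro eventually_at_in_open') auto
    moreover have "eventually (\<lambda>w. w \<noteq> 0) (at z)" by (rule eventually_neq_at_within)
    ultimately show ?thesis
    proof eventually_elim
      case (elim w)
      have "(k has_field_derivative deriv k w) (at w)"
        using k elim holomorphic_derivI open_ball by blast
      from DERIV_mult[OF DERIV_ident this]
      have "((\<lambda>w. w * k w) has_field_derivative k w + w * deriv k w) (at w)" by (simp add: mult.commute)
      then have "(g has_field_derivative k w + w * deriv k w) (at w)"
        by (rule has_field_derivative_transform_within_open[where S="ball 0 1"]) (use elim g in auto)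
      then have "deriv g w = k w + w * deriv k w" by (rule DERIV_imp_deriv)
      then show ?case using elim nz[of w] g[of w] by (simp add: field_simps)
    qed
  qed
  ultimately show "((\<lambda>w. w * deriv g w / g w) \<longlongrightarrow> 1 + z * deriv k z / k z) (at z)"
    by (rule Lim_transform_eventually)
qed

lemma starlike_of_orderE:
  assumes "g \<in> starlike_of_order lam"
  obtains k where "k holomorphic_on ball 0 1" "k 0 = 1" "\<And>z. g z = z * k z"
    "\<And>z. z \<in> ball 0 1 \<Longrightarrow> k z \<noteq> 0"
    "\<And>z. z \<in> ball 0 1 \<Longrightarrow> Re (1 + z * deriv k z / k z) > lam"
proof -
  from assms have g: "g holomorphic_on ball 0 1" "g 0 = 0" "deriv g 0 = 1" "inj_on g (ball 0 1)"
    and re: "\<And>z. z \<in> ball 0 1 \<Longrightarrow> Re (remove_sings (\<lambda>w. w * deriv g w / g w) z) > lam"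
    by (auto simp: starlike_of_order_def class_S_def class_A_def)
  obtain k where k: "k holomorphic_on ball 0 1" "\<And>z. g z = z * k z" "k 0 = deriv g 0"
    using holomorphic_factor_z[OF g(1,2)] by blast
  \<comment> \<open>At 0 the value is 1; a zero elsewhere would be a second zero of the univalent
    \<open>g\<close>.\<close>
  have nz: "k z \<noteq> 0" if "z \<in> ball 0 1" for z
  proof
    assume "k z = 0"
    then have "g z = g 0" "z \<noteq> 0" using k g by auto
    then show False using inj_onD[OF g(4), of z 0] that by simp
  qed
  have "Re (1 + z * deriv k z / k z) > lam" if "z \<in> ball 0 1" for z
    using re[OF that] remove_sings_log_deriv[OF k(1) nz k(2) that] by simp
  then show ?thesis using that k g nz by metis
qed

text \<open>Univalence is part of the class but is not a premise: with lam nonnegative, the bound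
  makes the logarithmic derivative positive, which yields injectivity.\<close>

lemma starlike_of_orderI:
  assumes k: "k holomorphic_on ball 0 1" "k 0 = 1" and g: "\<And>z. z \<in> ball 0 1 \<Longrightarrow> g z = z * k z"
    and nz: "\<And>z. z \<in> ball 0 1 \<Longrightarrow> k z \<noteq> 0"
    and re: "\<And>z. z \<in> ball 0 1 \<Longrightarrow> Re (1 + z * deriv k z / k z) > lam" and lam: "0 \<le> lam"
  shows "g \<in> starlike_of_order lam"
proof -
  have "(\<lambda>z. z * k z) holomorphic_on ball 0 1" using k by (intro holomorphic_intros)
  then have "g holomorphic_on ball 0 1" by (rule holomorphic_transform) (use g in auto)
  moreover have "deriv g 0 = 1"
  proof (rule DERIV_imp_deriv)
    have "(k has_field_derivative deriv k 0) (at 0)"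
      by (rule holomorphic_derivI[OF k(1)]) auto
    from DERIV_mult[OF DERIV_ident this]
    have "((\<lambda>w. w * k w) has_field_derivative 1) (at 0)" using k by simp
    then show "(g has_field_derivative 1) (at 0)"
      by (rule has_field_derivative_transform_within_open[where S="ball 0 1"]) (use g in auto)
  qed
  moreover have "inj_on g (ball 0 1)"
  proof -
    have "inj_on (\<lambda>z. z * k z) (ball 0 1)"
      by (rule Re_log_deriv_pos_imp_inj_on[OF k(1) nz]) (use re lam in \<open>auto intro: le_less_trans\<close>)
    then show ?thesis by (rule inj_on_cong[THEN iffD1, rotated]) (use g in auto)
  qed
  ultimately show ?thesis
    using g re remove_sings_log_deriv[OF k(1) nz g]
    by (simp add: starlike_of_order_def class_S_def class_A_def)
qed

theorem theorem2p10:
  fixes lam c \<sigma> :: real and f :: "complex \<Rightarrow> complex"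
  assumes "0 \<le> lam" and "lam < 1"
    and "c > -1"
    and "-lam \<le> c" and "c \<le> 1 - 2 * lam"
    and "f \<in> starlike_I \<sigma> lam"
  shows "I_op \<sigma> f \<in> starlike_bernardi c lam"
proof -
  \<comment> \<open>The assumption on \<open>f\<close> says that \<open>g\<close> is starlike of
    order lam, so the claim becomes that the Bernardi operator preserves this class.\<close>
  define g where "g = I_op \<sigma> f"
  have g: "g \<in> starlike_of_order lam" using assms(6) by (simp add: starlike_I_def g_def)
  then obtain k where k: "k holomorphic_on ball 0 1" "k 0 = 1" "\<And>z. g z = z * k z"
    "\<And>z. z \<in> ball 0 1 \<Longrightarrow> k z \<noteq> 0"
    "\<And>z. z \<in> ball 0 1 \<Longrightarrow> Re (1 + z * deriv k z / k z) > lam"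
    by (rule starlike_of_orderE) blast
  obtain h where h: "h holomorphic_on ball 0 1" "h 0 = k 0"
    "\<And>z. z \<in> ball 0 1 \<Longrightarrow> z * deriv h z + (of_real c + 1) * h z = (of_real c + 1) * k z"
    using bernardi_ode_solution_exists[OF k(1) assms(3)] by blast
  have "h z \<noteq> 0 \<and> Re (1 + z * deriv h z / h z) > lam" if "z \<in> ball 0 1" for z
    by (rule bernardi_preserves_log_deriv_bound[OF h(1) k(1) _ h(3) k(4,5) assms(3,4,1,2) that])
       (use h k in auto)
  moreover have "bernardi_op c g z = z * h z" if "z \<in> ball 0 1" for z
    by (rule bernardi_op_eq[OF h(1) assms(3) h(3) k(3) that])
  ultimately have "bernardi_op c g \<in> starlike_of_order lam"
    using h k assms(1) by (intro starlike_of_orderI[of h]) auto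
  moreover have "g \<in> class_A" using g by (simp add: starlike_of_order_def class_S_def)
  ultimately show ?thesis by (simp add: starlike_bernardi_def g_def)
qed

end
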